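(* Let $x>0$ and $k>0$ be real numbers and let $n\ge 0$ be an integer. Then $$\int_0^\infty u^{x-1}e^{-ku}\log^n u\,du=\frac{1}{k^x}\sum_{j=0}^{n}(-1)^{n-j}\binom{n}{j}\Gamma^{(j)}(x)\log^{n-j}k.$$
   Context: $\Gamma^{(j)}$ denotes the $j$-th derivative of the gamma function $\Gamma(x)=\int_0^\infty u^{x-1}e^{-u}\,du$, with $\Gamma^{(0)}=\Gamma$. $\log^m y$ means $(\log y)^m$, with the convention $(\log k)^0=1$ (also when $k=1$). *)

theory Defs
  imports "HOL-Analysis.Analysis"
begin

end

theory Submission
  imports Defs
begin

text \<open>
  For \<open>k = 1\<close> the integrals are the derivatives of \<open>\<Gamma>\<close>: the bound
  \<open>\<bar>ln u\<bar> ^ n \<le> n! / e ^ n * (u powr e + u powr - e)\<close> reduces integrability to that of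
  shifted Gamma integrands and also dominates the difference quotients in \<open>x\<close>, so one may
  differentiate under the integral sign. The substitution \<open>u = t / k\<close> and the binomial
  expansion of \<open>(ln t - ln k) ^ n\<close> give the general case.
\<close>

section \<open>Elementary bounds for logarithms and real powers\<close>

text \<open>A single term of the exponential series is at most the whole sum, since all terms are
  nonnegative.\<close>

lemma power_le_fact_mult_exp:
  fixes y :: real
  assumes "0 \<le> y"
  shows "y ^ n \<le> fact n * exp y"
proof -
  have "(\<Sum>i\<in>{n}. y ^ i /\<^sub>R fact i) \<le> (\<Sum>i. y ^ i /\<^sub>R fact i)"
    using assms by (intro sum_le_suminf summable_exp_generic) auto
  then show ?thesis
    by (simp add: exp_def field_simps)
qed

text \<open>The previous bound at \<open>e * abs (ln u)\<close>: its exponential is one of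
  \<open>u powr e\<close> and \<open>u powr - e\<close>, depending on the sign of
  \<open>ln u\<close>, and the sum covers both. Since \<open>e\<close> may be arbitrarily small, a
  logarithmic factor costs only a small shift of the exponent.\<close>

lemma abs_ln_power_le:
  fixes u e :: real
  assumes "0 < u" "0 < e"
  shows "\<bar>ln u\<bar> ^ n \<le> fact n / e ^ n * (u powr e + u powr - e)"
proof -
  have "(e * \<bar>ln u\<bar>) ^ n \<le> fact n * exp (e * \<bar>ln u\<bar>)"
    using assms by (intro power_le_fact_mult_exp) auto
  also have "exp (e * \<bar>ln u\<bar>) \<le> u powr e + u powr - e"
    using assms by (cases "ln u \<ge> 0") (auto simp: powr_def)
  finally have "(e * \<bar>ln u\<bar>) ^ n \<le> fact n * (u powr e + u powr - e)"
    by simp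
  then show ?thesis
    using assms by (simp add: power_mult_distrib field_simps)
qed

text \<open>As a function of the exponent, \<open>u powr c\<close> is monotone, in a direction that
  depends on whether \<open>u\<close> is below or above 1. One endpoint therefore dominates, and the
  sum gives a bound uniform in both \<open>u\<close> and \<open>c\<close>.\<close>

lemma powr_le_powr_add_powr:
  fixes u a b c :: real
  assumes "0 < u" "a \<le> c" "c \<le> b"
  shows "u powr c \<le> u powr a + u powr b"
proof (cases "u \<le> 1")
  case True
  then have "u powr c \<le> u powr a"
    using assms by (intro powr_mono') auto
  then show ?thesis
    by (simp add: add_increasing2)
next
  case False
  then have "u powr c \<le> u powr b"
    using assms by (intro powr_mono) auto
  then show ?thesis
    by (simp add: add_increasing)
qed

section \<open>Integrability of Gamma integrands with logarithmic factors\<close>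

lemma has_integral_Gamma_Ioi:
  assumes "0 < (x::real)"
  shows "((\<lambda>u. u powr (x - 1) * exp (- u)) has_integral Gamma x) {0<..}"
proof -
  have "((\<lambda>u. if u \<in> {0<..} then u powr (x - 1) * exp (- u) else 0) has_integral Gamma x) {0..}"
    by (rule has_integral_spike[OF _ _ Gamma_integral_real[OF assms], of "{0}"])
       (auto simp: exp_minus field_simps)
  then show ?thesis
    by (subst (asm) has_integral_restrict) auto
qed

lemma set_integrable_Gamma:
  assumes "0 < (x::real)"
  shows "set_integrable lborel {0<..} (\<lambda>u. u powr (x - 1) * exp (- u))"
proof -
  have "(\<lambda>u. u powr (x - 1) * exp (- u)) absolutely_integrable_on {0<..}"
    using has_integral_Gamma_Ioi[OF assms]
    by (intro nonnegative_absolutely_integrable_1) auto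
  then show ?thesis
    \<comment> \<open>Absolute integrability refers to \<open>lebesgue\<close>, the completion of
      \<open>lborel\<close>; it descends to \<open>lborel\<close> because the integrand is Borel
      measurable.\<close>
    unfolding set_integrable_def by (subst (asm) integrable_completion) auto
qed

lemma set_integrable_Gamma_abs_ln_power:
  fixes x :: real
  assumes "0 < x"
  shows "set_integrable lborel {0<..} (\<lambda>u. u powr (x - 1) * exp (- u) * \<bar>ln u\<bar> ^ n)"
proof (rule set_integrable_bound)
  \<comment> \<open>The choice \<open>e = x / 2\<close> shifts the Gamma parameter \<open>x\<close>
    to \<open>3 * x / 2\<close> and \<open>x / 2\<close>, both still positive.\<close>
  let ?C = "fact n / (x / 2) ^ n"
  show "set_integrable lborel {0<..}
          (\<lambda>u. ?C * (u powr ((3 * x / 2) - 1) * exp (- u) + u powr (x / 2 - 1) * exp (- u)))"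
    using assms by (intro set_integrable_mult_right set_integral_add set_integrable_Gamma) auto
  show "set_borel_measurable lborel {0<..} (\<lambda>u. u powr (x - 1) * exp (- u) * \<bar>ln u\<bar> ^ n)"
    unfolding set_borel_measurable_def by measurable
  show "AE u in lborel. u \<in> {0<..} \<longrightarrow>
      norm (u powr (x - 1) * exp (- u) * \<bar>ln u\<bar> ^ n)
      \<le> norm (?C * (u powr ((3 * x / 2) - 1) * exp (- u) + u powr (x / 2 - 1) * exp (- u)))"
  proof (intro AE_I2 impI)
    fix u :: real
    assume "u \<in> {0<..}"
    then have u: "0 < u" by simp
    have "u powr (x - 1) * exp (- u) * \<bar>ln u\<bar> ^ n
        \<le> u powr (x - 1) * exp (- u) * (?C * (u powr (x / 2) + u powr - (x / 2)))"
      using assms u by (intro mult_left_mono abs_ln_power_le) auto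
    also have "\<dots> = ?C * (u powr (x - 1) * u powr (x / 2) * exp (- u)
                        + u powr (x - 1) * u powr - (x / 2) * exp (- u))"
      by (simp add: algebra_simps)
    also have "u powr (x - 1) * u powr (x / 2) = u powr (3 * x / 2 - 1)"
      by (simp flip: powr_add add: field_simps)
    also have "u powr (x - 1) * u powr - (x / 2) = u powr (x / 2 - 1)"
      by (simp flip: powr_add add: field_simps)
    finally show "norm (u powr (x - 1) * exp (- u) * \<bar>ln u\<bar> ^ n)
      \<le> norm (?C * (u powr ((3 * x / 2) - 1) * exp (- u) + u powr (x / 2 - 1) * exp (- u)))"
      using assms by (simp add: abs_mult power_abs)
  qed
qed

lemma set_integrable_Gamma_ln_power:
  fixes x :: real
  assumes "0 < x"
  shows "set_integrable lborel {0<..} (\<lambda>u. u powr (x - 1) * exp (- u) * ln u ^ n)"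
proof (rule set_integrable_bound[OF set_integrable_Gamma_abs_ln_power[OF assms, of n]])
  show "set_borel_measurable lborel {0<..} (\<lambda>u. u powr (x - 1) * exp (- u) * ln u ^ n)"
    unfolding set_borel_measurable_def by measurable
qed (auto simp: abs_mult power_abs)

section \<open>Differentiation under the integral sign\<close>

lemma has_field_derivative_powr_exponent:
  fixes u z :: real
  assumes "0 < u"
  shows "((\<lambda>z. u powr (z - 1)) has_field_derivative ln u * u powr (z - 1)) (at z within A)"
proof -
  have "((\<lambda>z. exp ((z - 1) * ln u)) has_field_derivative ln u * exp ((z - 1) * ln u)) (at z within A)"
    by (auto intro!: derivative_eq_intros)
  then show ?thesis
    using assms by (simp add: powr_def)
qed

text \<open>Mean value inequality on the convex set \<open>{a..b}\<close>, with the derivative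
  bounded through the endpoint exponents. The bound is independent of \<open>x\<close> and
  \<open>y\<close>, as dominated convergence requires.\<close>

lemma powr_diff_quotient_le:
  fixes u a b x y :: real
  assumes u: "0 < u" and x: "x \<in> {a..b}" and y: "y \<in> {a..b}"
  shows "\<bar>(u powr (y - 1) - u powr (x - 1)) / (y - x)\<bar>
    \<le> \<bar>ln u\<bar> * (u powr (a - 1) + u powr (b - 1))"
proof -
  have "norm (u powr (y - 1) - u powr (x - 1))
      \<le> \<bar>ln u\<bar> * (u powr (a - 1) + u powr (b - 1)) * norm (y - x)"
  proof (rule field_differentiable_bound[where f = "\<lambda>z. u powr (z - 1)" and S = "{a..b}"
        and f' = "\<lambda>z. ln u * u powr (z - 1)"])
    fix z
    assume z: "z \<in> {a..b}"
    show "((\<lambda>z. u powr (z - 1)) has_field_derivative ln u * u powr (z - 1)) (at z within {a..b})"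
      by (rule has_field_derivative_powr_exponent[OF u])
    show "norm (ln u * u powr (z - 1)) \<le> \<bar>ln u\<bar> * (u powr (a - 1) + u powr (b - 1))"
      using mult_left_mono[OF powr_le_powr_add_powr[of u "a - 1" "z - 1" "b - 1"], of "\<bar>ln u\<bar>"] u z
      by (simp add: abs_mult)
  qed (use x y in auto)
  then show ?thesis
    \<comment> \<open>For \<open>y = x\<close> the quotient is 0 by the convention for division by
      zero, and the bound is nonnegative.\<close>
    by (cases "y = x") (auto simp: field_simps abs_divide)
qed

lemma has_field_derivative_Gamma_ln_power_integral:
  fixes x :: real
  assumes x: "0 < x"
  shows "((\<lambda>x. LBINT u:{0<..}. u powr (x - 1) * exp (- u) * ln u ^ n) has_field_derivative
          (LBINT u:{0<..}. u powr (x - 1) * exp (- u) * ln u ^ Suc n)) (at x)"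
    (is "(?F has_field_derivative ?D) _")
proof -
  \<comment> \<open>A neighbourhood of \<open>x\<close> bounded away from 0. Taking the limit within
    it puts every member of an approaching sequence, not just a tail, under the same dominating
    function.\<close>
  let ?S = "{x / 2<..<2 * x}"
  let ?q = "\<lambda>y u. (u powr (y - 1) - u powr (x - 1)) / (y - x)"
  let ?g = "\<lambda>y u. indicator {0<..} u *\<^sub>R (?q y u * exp (- u) * ln u ^ n)"
  \<comment> \<open>The quotient bound with \<open>a = x / 2\<close> and \<open>b = 2 * x\<close>;
    its factor \<open>abs (ln u)\<close> raises the logarithmic power from \<open>n\<close> to
    \<open>Suc n\<close>.\<close>
  let ?w = "\<lambda>u. indicator {0<..} u *\<^sub>R (u powr (x / 2 - 1) * exp (- u) * \<bar>ln u\<bar> ^ Suc n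
              + u powr (2 * x - 1) * exp (- u) * \<bar>ln u\<bar> ^ Suc n)"
  have "((\<lambda>y. (?F y - ?F x) / (y - x)) \<longlongrightarrow> ?D) (at x within ?S)"
    \<comment> \<open>Dominated convergence is applied along sequences.\<close>
    unfolding tendsto_at_iff_sequentially
  proof (intro allI impI)
    fix X
    assume X: "\<forall>i. X i \<in> ?S - {x}" and lim: "X \<longlonglongrightarrow> x"
    have "(?F (X i) - ?F x) / (X i - x) = (\<integral>u. ?g (X i) u \<partial>lborel)" for i
    proof -
      have "0 < X i"
        using X x by (metis DiffD1 greaterThanLessThan_iff half_gt_zero less_trans)
      then have "?F (X i) - ?F x = (LBINT u:{0<..}. u powr (X i - 1) * exp (- u) * ln u ^ n
                                        - u powr (x - 1) * exp (- u) * ln u ^ n)"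
        using x by (intro set_integral_diff(2)[symmetric] set_integrable_Gamma_ln_power)
      then have "(?F (X i) - ?F x) / (X i - x) =
          (LBINT u:{0<..}. (u powr (X i - 1) * exp (- u) * ln u ^ n
                                        - u powr (x - 1) * exp (- u) * ln u ^ n) / (X i - x))"
        by simp
      then show ?thesis
        by (simp add: set_lebesgue_integral_def algebra_simps diff_divide_distrib)
    qed
    moreover have "(\<lambda>i. \<integral>u. ?g (X i) u \<partial>lborel) \<longlonglongrightarrow> ?D"
      unfolding set_lebesgue_integral_def
    proof (rule integral_dominated_convergence[where w = ?w])
      show "integrable lborel ?w"
        using x set_integral_add(1)[OF set_integrable_Gamma_abs_ln_power[of "x / 2" "Suc n"]
            set_integrable_Gamma_abs_ln_power[of "2 * x" "Suc n"]]
        by (simp add: set_integrable_def)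
      show "AE u in lborel. (\<lambda>i. ?g (X i) u) \<longlonglongrightarrow>
          indicator {0<..} u *\<^sub>R (u powr (x - 1) * exp (- u) * ln u ^ Suc n)"
      proof (intro AE_I2)
        fix u :: real
        show "(\<lambda>i. ?g (X i) u) \<longlonglongrightarrow>
          indicator {0<..} u *\<^sub>R (u powr (x - 1) * exp (- u) * ln u ^ Suc n)"
        proof (cases "0 < u")
          case True
          then have "((\<lambda>y. u powr (y - 1)) has_field_derivative ln u * u powr (x - 1)) (at x)"
            by (rule has_field_derivative_powr_exponent)
          then have "((\<lambda>y. ?q y u) \<longlongrightarrow> ln u * u powr (x - 1)) (at x)"
            by (simp add: has_field_derivative_iff)
          then have "(\<lambda>i. ?q (X i) u) \<longlonglongrightarrow> ln u * u powr (x - 1)"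
            using X lim by (auto simp: tendsto_at_iff_sequentially comp_def)
          then have "(\<lambda>i. ?q (X i) u * exp (- u) * ln u ^ n) \<longlonglongrightarrow>
              ln u * u powr (x - 1) * exp (- u) * ln u ^ n"
            by (intro tendsto_intros)
          then show ?thesis
            using True by (simp add: mult_ac)
        qed auto
      qed
      show "AE u in lborel. norm (?g (X i) u) \<le> ?w u" for i
      proof (intro AE_I2)
        fix u :: real
        show "norm (?g (X i) u) \<le> ?w u"
        proof (cases "0 < u")
          case True
          have "x \<in> {x / 2..2 * x}" "X i \<in> {x / 2..2 * x}"
            using x X by (auto simp: less_imp_le)
          from powr_diff_quotient_le[OF True this]
          have "\<bar>?q (X i) u\<bar> * (exp (- u) * \<bar>ln u\<bar> ^ n)
              \<le> \<bar>ln u\<bar> * (u powr (x / 2 - 1) + u powr (2 * x - 1)) * (exp (- u) * \<bar>ln u\<bar> ^ n)"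
            by (intro mult_right_mono) auto
          moreover have "norm (?g (X i) u) = \<bar>?q (X i) u\<bar> * (exp (- u) * \<bar>ln u\<bar> ^ n)"
            using True by (simp add: abs_mult power_abs mult.assoc)
          moreover have "?w u
              = \<bar>ln u\<bar> * (u powr (x / 2 - 1) + u powr (2 * x - 1)) * (exp (- u) * \<bar>ln u\<bar> ^ n)"
            using True by (simp add: algebra_simps)
          ultimately show ?thesis
            by linarith
        qed auto
      qed
    qed measurable
    ultimately show "((\<lambda>y. (?F y - ?F x) / (y - x)) \<circ> X) \<longlonglongrightarrow> ?D"
      by (simp only: comp_def)
  qed
  moreover have "at x within ?S = at x"
    using x by (intro at_within_open) auto
  ultimately show ?thesis
    by (simp add: has_field_derivative_iff)
qed

section \<open>Derivatives of Gamma as integrals\<close>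

lemma higher_deriv_Gamma_conv_integral:
  fixes x :: real
  assumes "0 < x"
  shows "(deriv ^^ n) Gamma x = (LBINT u:{0<..}. u powr (x - 1) * exp (- u) * ln u ^ n)"
  using assms
proof (induction n arbitrary: x)
  case 0
  have "((\<lambda>u. u powr (x - 1) * exp (- u)) has_integral Gamma x) {0<..}"
    by (rule has_integral_Gamma_Ioi) fact
  then show ?case
    using set_borel_integral_eq_integral(2)[OF set_integrable_Gamma[OF 0]]
    by (simp add: integral_unique)
next
  case (Suc n)
  \<comment> \<open>The induction hypothesis covers positive arguments only; this determines the
    derivative at \<open>x\<close> because they form an open set.\<close>
  have "\<forall>\<^sub>F y in nhds x. y \<in> {0<..}"
    using Suc.prems by (intro eventually_nhds_in_open) auto
  then have "\<forall>\<^sub>F y in nhds x. (deriv ^^ n) Gamma y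
      = (LBINT u:{0<..}. u powr (y - 1) * exp (- u) * ln u ^ n)"
    by eventually_elim (simp add: Suc.IH)
  then have "deriv ((deriv ^^ n) Gamma) x
      = deriv (\<lambda>y. LBINT u:{0<..}. u powr (y - 1) * exp (- u) * ln u ^ n) x"
    by (rule deriv_cong_ev) simp
  then show ?case
    using DERIV_imp_deriv[OF has_field_derivative_Gamma_ln_power_integral[OF Suc.prems, of n]]
    by simp
qed

section \<open>General \<open>k\<close> by scaling and binomial expansion\<close>

theorem mainTheorem2:
  fixes x k :: real and n :: nat
  assumes "x > 0" and "k > 0"
  shows "set_integrable lborel {0<..} (\<lambda>u::real. u powr (x - 1) * exp (- k * u) * ln u ^ n)
    \<and> (LBINT u:{0<..}. u powr (x - 1) * exp (- k * u) * ln u ^ n)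
      = 1 / k powr x *
        (\<Sum>j=0..n. (-1) ^ (n - j) * real (n choose j) * (deriv ^^ j) Gamma x * ln k ^ (n - j))"
proof -
  define f where "f u = indicator {0<..} u *\<^sub>R (u powr (x - 1) * exp (- k * u) * ln u ^ n)"
    for u :: real
  \<comment> \<open>The factor \<open>k powr (1 - x)\<close> comes from
    \<open>(t / k) powr (x - 1)\<close>; the Jacobian \<open>1 / k\<close> of the substitution later
    turns it into \<open>1 / k powr x\<close>.\<close>
  define c where "c j = k powr (1 - x) * ((-1) ^ (n - j) * real (n choose j) * ln k ^ (n - j))"
    for j
  define g where "g j t = c j * (indicator {0<..} t *\<^sub>R (t powr (x - 1) * exp (- t) * ln t ^ j))"
    for j and t :: real
  \<comment> \<open>The substitution \<open>u = t / k\<close>, written as an affine map to match the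
    change of variables for \<open>lborel\<close>. For \<open>t\<close> not positive both sides
    vanish through the indicators.\<close>
  have f_eq: "f (0 + 1 / k * t) = (\<Sum>j=0..n. g j t)" for t
  proof (cases "0 < t")
    case True
    have "ln (t / k) ^ n = (ln t + (- ln k)) ^ n"
      using True assms by (simp add: ln_div)
    also have "\<dots> = (\<Sum>j=0..n. real (n choose j) * ln t ^ j * (- ln k) ^ (n - j))"
      by (simp only: binomial_ring atLeast0AtMost)
    also have "\<dots> = (\<Sum>j=0..n. (-1) ^ (n - j) * real (n choose j) * ln k ^ (n - j) * ln t ^ j)"
      by (intro sum.cong refl, subst power_minus) (simp add: mult_ac)
    finally have "(t / k) powr (x - 1) * exp (- t) * ln (t / k) ^ n
        = k powr (1 - x) * t powr (x - 1) * exp (- t)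
          * (\<Sum>j=0..n. (-1) ^ (n - j) * real (n choose j) * ln k ^ (n - j) * ln t ^ j)"
      using True assms powr_minus_divide[of k "x - 1"] by (simp add: powr_divide)
    then show ?thesis
      using True assms
      by (simp add: f_def g_def c_def sum_distrib_left mult_ac)
  next
    case False
    then show ?thesis
      using assms by (simp add: f_def g_def zero_less_divide_iff)
  qed
  have g_int: "integrable lborel (g j)" for j
    unfolding g_def using set_integrable_Gamma_ln_power[OF assms(1), of j]
    by (intro integrable_mult_right) (simp add: set_integrable_def)
  have g_integral: "(\<integral>t. g j t \<partial>lborel) = c j * (deriv ^^ j) Gamma x" for j
    unfolding g_def higher_deriv_Gamma_conv_integral[OF assms(1)] set_lebesgue_integral_def
    by (rule integral_mult_right_zero)
  have "integrable lborel (\<lambda>t. f (0 + 1 / k * t))"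
    unfolding f_eq using g_int by (intro Bochner_Integration.integrable_sum)
  \<comment> \<open>Integrability passes back through the affine map because its slope
    \<open>1 / k\<close> is nonzero.\<close>
  then have "integrable lborel f"
    using assms by (subst (asm) lborel_integrable_real_affine_iff) auto
  moreover have "(\<integral>u. f u \<partial>lborel) = 1 / k powr x *
        (\<Sum>j=0..n. (-1) ^ (n - j) * real (n choose j) * (deriv ^^ j) Gamma x * ln k ^ (n - j))"
  proof -
    have "(\<integral>u. f u \<partial>lborel) = 1 / k * (\<Sum>j=0..n. c j * (deriv ^^ j) Gamma x)"
      using assms lborel_integral_real_affine[of "1 / k" f 0]
      unfolding f_eq by (simp add: g_int g_integral)
    also have "\<dots> = (\<Sum>j=0..n. k powr (1 - x) / k *
        ((-1) ^ (n - j) * real (n choose j) * (deriv ^^ j) Gamma x * ln k ^ (n - j)))"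
      by (simp add: c_def sum_distrib_left mult_ac)
    also have "k powr (1 - x) / k = 1 / k powr x"
      using assms by (simp add: powr_diff)
    finally show ?thesis
      by (simp only: sum_distrib_left)
  qed
  ultimately show ?thesis
    by (simp add: f_def [abs_def] set_integrable_def set_lebesgue_integral_def)
qed

end
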